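(* Assume that every operator $f$ preserves refinement, i.e. for all precisions $q>p$ and all flagged intervals $I_1,\dots,I_n$ (endpoints in $S_p$) and $I_1',\dots,I_n'$ (endpoints in $S_q$) with $I_i'\prec I_i$ for every $i$, one has $f_q(I_1',\dots,I_n')\prec f_p(I_1,\dots,I_n)$. Then for every expression $e$, every input point $x$, and all precisions $q>p$, $$[\![ e ]\!]_q(x)\;\prec\;[\![ e ]\!]_p(x).$$
   Context: Arbitrary-precision arithmetic: for each precision $p$ there is a finite set $S_p\subset\mathbb{R}\cup\{\pm\infty\}$ of representable values containing $\pm\infty$; values representable at precision $p$ are representable at all higher precisions, i.e. $S_p\subseteq S_q$ for $q>p$. $R_p^{\downarrow}$ and $R_p^{\uparrow}$ denote rounding down and up to $S_p$. There is a fixed target precision, and all precisions $p,q$ considered are at least the target precision. Flagged intervals: an interval at precision $p$ is a pair $[a,b]$ with $a\le b$, $a,b\in S_p$, representing $\{x\in\mathbb{R}\cup\{\pm\infty\}: a\le x\le b\}$. Each of its two endpoints additionally carries a boolean movability flag; an endpoint is called immovable if its flag is set and movable otherwise. Refinement: $[a',b']\prec[a,b]$ (read: $[a',b']$ refines $[a,b]$) holds when both of the following hold: (right endpoint) either $b'=b$ and both $b$ and $b'$ are immovable, or $b'\le b$ and $b$ is movable; (left endpoint) either $a'=a$ and both $a$ and $a'$ are immovable, or $a'\ge a$ and $a$ is movable. Expressions $e$ are built from constants, variables, and applications of operators. Each $n$-ary operator $f$ comes, for each precision $p$, with an interval version $f_p$ mapping $n$ flagged intervals with endpoints in $S_p$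 to a flagged interval with endpoints in $S_p$. Interval evaluation $[\![ e ]\!]_p(x)$ at precision $p$ of $e$ on an input point $x$ (an assignment of values of the target precision to the variables) is defined recursively: a variable with value $v$ evaluates to $[v,v]$ with both endpoints immovable; a constant $c$ (such as $\pi$) evaluates to $[R_p^{\downarrow}(c),R_p^{\uparrow}(c)]$ with both endpoints movable; an application $f(e_1,\dots,e_n)$ evaluates to $f_p([\![ e_1 ]\!]_p(x),\dots,[\![ e_n ]\!]_p(x))$. *)

theory Defs
  imports "HOL-Library.Extended_Real"
begin

text \<open>
  The carrier \<open>\<real> \<union> {\<plusminus>\<infinity>}\<close> is \<^typ>\<open>ereal\<close>.  Precisions are elements of an arbitrary linear
  order \<open>'p\<close>; \<open>S p\<close> is the set of values representable at precision \<open>p\<close>.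
\<close>

locale representable_values =
  fixes S :: "'p::linorder \<Rightarrow> ereal set"
  assumes finite_S: "finite (S p)"
    and minus_infinity_in_S: "-\<infinity> \<in> S p"
    and plus_infinity_in_S: "\<infinity> \<in> S p"
    and S_mono: "p < q \<Longrightarrow> S p \<subseteq> S q"

text \<open>
  \<^const>\<open>Max\<close> and \<^const>\<open>Min\<close> are meaningful here: the sets are finite, and nonempty because
  \<open>S p\<close> contains both infinities.
\<close>

definition round_down :: "('p \<Rightarrow> ereal set) \<Rightarrow> 'p \<Rightarrow> ereal \<Rightarrow> ereal" where
  "round_down S p c = Max {s \<in> S p. s \<le> c}"

definition round_up :: "('p \<Rightarrow> ereal set) \<Rightarrow> 'p \<Rightarrow> ereal \<Rightarrow> ereal" where
  "round_up S p c = Min {s \<in> S p. c \<le> s}"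

text \<open>An endpoint is movable iff its \<open>immovable\<close> flag is not set.\<close>

datatype flagged_interval =
  Flagged_Interval (lo: ereal) (hi: ereal) (lo_immovable: bool) (hi_immovable: bool)

definition flagged_intervals :: "('p \<Rightarrow> ereal set) \<Rightarrow> 'p \<Rightarrow> flagged_interval set" where
  "flagged_intervals S p = {I. lo I \<in> S p \<and> hi I \<in> S p \<and> lo I \<le> hi I}"

definition refines :: "flagged_interval \<Rightarrow> flagged_interval \<Rightarrow> bool" where
  "refines I' I \<longleftrightarrow>
     ((hi I' = hi I \<and> hi_immovable I \<and> hi_immovable I') \<or>
      (hi I' \<le> hi I \<and> \<not> hi_immovable I)) \<and>
     ((lo I' = lo I \<and> lo_immovable I \<and> lo_immovable I') \<or>
      (lo I' \<ge> lo I \<and> \<not> lo_immovable I))"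

text \<open>
  Operators are symbols of type \<open>'f\<close> with an arity; \<open>F p f\<close> is the interval version of \<open>f\<close> at
  precision \<open>p\<close>.  It is only constrained on argument lists of the right length that consist of
  flagged intervals at precision \<open>p\<close>, and only for \<open>p\<close> at least the target precision.
\<close>

locale interval_operators = representable_values S
  for S :: "'p::linorder \<Rightarrow> ereal set" +
  fixes target :: 'p
    and arity :: "'f \<Rightarrow> nat"
    and F :: "'p \<Rightarrow> 'f \<Rightarrow> flagged_interval list \<Rightarrow> flagged_interval"
  assumes F_closed:
    "target \<le> p \<Longrightarrow> length Is = arity f \<Longrightarrow> set Is \<subseteq> flagged_intervals S p \<Longrightarrow>
      F p f Is \<in> flagged_intervals S p"

definition preserves_refinement ::
  "('p::linorder \<Rightarrow> ereal set) \<Rightarrow> 'p \<Rightarrow> ('f \<Rightarrow> nat) \<Rightarrow>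
   ('p \<Rightarrow> 'f \<Rightarrow> flagged_interval list \<Rightarrow> flagged_interval) \<Rightarrow> 'f \<Rightarrow> bool" where
  "preserves_refinement S target arity F f \<longleftrightarrow>
     (\<forall>p q Is Is'. target \<le> p \<longrightarrow> p < q \<longrightarrow>
        length Is = arity f \<longrightarrow> length Is' = arity f \<longrightarrow>
        set Is \<subseteq> flagged_intervals S p \<longrightarrow> set Is' \<subseteq> flagged_intervals S q \<longrightarrow>
        (\<forall>i < arity f. refines (Is' ! i) (Is ! i)) \<longrightarrow>
        refines (F q f Is') (F p f Is))"

datatype ('f, 'v) expr =
  Const ereal
| Var 'v
| App 'f "('f, 'v) expr list"

primrec wf_expr :: "('f \<Rightarrow> nat) \<Rightarrow> ('f, 'v) expr \<Rightarrow> bool" where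
  "wf_expr arity (Const c) \<longleftrightarrow> True"
| "wf_expr arity (Var v) \<longleftrightarrow> True"
| "wf_expr arity (App f es) \<longleftrightarrow> length es = arity f \<and> list_all (wf_expr arity) es"

primrec ieval ::
  "('p \<Rightarrow> ereal set) \<Rightarrow> ('p \<Rightarrow> 'f \<Rightarrow> flagged_interval list \<Rightarrow> flagged_interval) \<Rightarrow>
   'p \<Rightarrow> ('v \<Rightarrow> ereal) \<Rightarrow> ('f, 'v) expr \<Rightarrow> flagged_interval" where
  "ieval S F p x (Const c) = Flagged_Interval (round_down S p c) (round_up S p c) False False"
| "ieval S F p x (Var v) = Flagged_Interval (x v) (x v) True True"
| "ieval S F p x (App f es) = F p f (map (ieval S F p x) es)"

end

theory Submission
  imports Defs
begin

text \<open>Structural induction on \<open>e\<close>. For a constant, \<open>S p\<close> \<subseteq>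
  \<open>S q\<close> gives rounding at \<open>q\<close> more candidates, so the lower bound can only
  rise and the upper bound only drop; both endpoints are movable, so this is refinement. A variable
  yields the same immovable point at both precisions. For an application, the induction hypothesis
  refines each argument and the assumption on the operator carries this to the result. That
  assumption only covers genuine flagged intervals, so \<open>ieval_in_flagged_intervals\<close> is
  proved separately.\<close>

context representable_values
begin

lemma S_subset: "p \<le> q \<Longrightarrow> S p \<subseteq> S q"
  using S_mono[of p q] by (cases "p = q") auto

text \<open>The infinities witness nonemptiness, so the \<open>Max\<close> and \<open>Min\<close> in
  the rounding functions are attained.\<close>

lemma
  shows finite_below: "finite {s \<in> S p. s \<le> c}"
    and below_nonempty: "{s \<in> S p. s \<le> c} \<noteq> {}"
    and finite_above: "finite {s \<in> S p. c \<le> s}"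
    and above_nonempty: "{s \<in> S p. c \<le> s} \<noteq> {}"
  using finite_S[of p] minus_infinity_in_S[of p] plus_infinity_in_S[of p]
  by (auto intro: exI[of _ "-\<infinity>"] exI[of _ "\<infinity>"])

lemma
  shows round_down_in_S: "round_down S p c \<in> S p"
    and round_down_le: "round_down S p c \<le> c"
  using Max_in[OF finite_below below_nonempty, of p c] by (auto simp: round_down_def)

lemma
  shows round_up_in_S: "round_up S p c \<in> S p"
    and le_round_up: "c \<le> round_up S p c"
  using Min_in[OF finite_above above_nonempty, of p c] by (auto simp: round_up_def)

lemma round_down_mono_precision:
  assumes "p \<le> q"
  shows "round_down S p c \<le> round_down S q c"
  unfolding round_down_def
  using S_subset[OF assms] by (intro Max_mono below_nonempty finite_below) auto

lemma round_up_antimono_precision: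
  assumes "p \<le> q"
  shows "round_up S q c \<le> round_up S p c"
  unfolding round_up_def
  using S_subset[OF assms] by (intro Min_antimono above_nonempty finite_above) auto

end

text \<open>Supplies the membership premises of \<open>preserves_refinement\<close> for the
  evaluated arguments.\<close>

lemma (in interval_operators) ieval_in_flagged_intervals:
  assumes "wf_expr arity e" and x: "\<And>v. x v \<in> S target" and p: "target \<le> p"
  shows "ieval S F p x e \<in> flagged_intervals S p"
  using assms(1)
proof (induction e)
  case (Const c)
  show ?case
    \<comment> \<open>The constant \<open>c\<close> lies between its two roundings, which orders the
      endpoints.\<close>
    using round_down_le[of p c] le_round_up[of c p]
    by (auto simp: flagged_intervals_def round_down_in_S round_up_in_S)
next
  case (Var v)
  show ?case using S_subset[OF p] x[of v] by (auto simp: flagged_intervals_def)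
next
  case (App f es)
  then have "set (map (ieval S F p x) es) \<subseteq> flagged_intervals S p"
    by (auto simp: list_all_iff)
  with App.prems show ?case by (simp add: F_closed p del: set_map)
qed

theorem theorem3:
  fixes S :: "'p::linorder \<Rightarrow> ereal set"
    and target p q :: 'p
    and arity :: "'f \<Rightarrow> nat"
    and F :: "'p \<Rightarrow> 'f \<Rightarrow> flagged_interval list \<Rightarrow> flagged_interval"
    and e :: "('f, 'v) expr"
    and x :: "'v \<Rightarrow> ereal"
  assumes "interval_operators S target arity F"
    and "\<And>f. preserves_refinement S target arity F f"
    and "wf_expr arity e"
    and "\<And>v. x v \<in> S target"
    and "target \<le> p" and "p < q"
  shows "refines (ieval S F q x e) (ieval S F p x e)"
proof -
  interpret interval_operators S target arity F by fact
  show ?thesis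
    using assms(3)
  proof (induction e)
    case (Const c)
    show ?case
      using \<open>p < q\<close>
      by (simp add: refines_def round_down_mono_precision round_up_antimono_precision)
  next
    case (Var v)
    show ?case by (simp add: refines_def)
  next
    case (App f es)
    have len: "length es = arity f" and wf: "\<And>e. e \<in> set es \<Longrightarrow> wf_expr arity e"
      using App.prems by (auto simp: list_all_iff)
    \<comment> \<open>Stated for a general \<open>r\<close> because it is used at both
      \<open>p\<close> and \<open>q\<close>.\<close>
    have closed: "set (map (ieval S F r x) es) \<subseteq> flagged_intervals S r" if "target \<le> r" for r
      using ieval_in_flagged_intervals[OF wf assms(4) that] by auto
    have "target \<le> q" using \<open>target \<le> p\<close> \<open>p < q\<close> by simp
    moreover have "\<forall>i < arity f.
        refines (map (ieval S F q x) es ! i) (map (ieval S F p x) es ! i)"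
      using App.IH wf by (simp flip: len)
    ultimately show ?case
      using assms(2)[of f] \<open>target \<le> p\<close> \<open>p < q\<close> closed len
      unfolding preserves_refinement_def ieval.simps by (metis length_map)
  qed
qed

end
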